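(* Assume that $F$ is closed and convex. Let $\rho>0$ and let $\mathcal{A}$ be an event on which the following two properties hold: (i) for every $f\in F\cap B_\Psi(\rho,f^* )$ with $\|f-f^*\|_{L_2(\mu)}\ge r(\rho)$ one has $P_N\mathcal{L}_f\ge\frac{\theta}{2}\|f-f^*\|_{L_2(\mu)}^2$; (ii) $\mathcal{O}(\rho)\le\frac{\theta}{8}r^2(\rho)$. Set $\gamma_{\mathcal{O}}(\rho)=\sup_{\omega\in\mathcal{A}}\mathcal{O}(\rho)$. Let $\lambda>0$. If $\Delta(\rho)\ge 4\rho/5$ and $$3\,\frac{\gamma_{\mathcal{O}}(\rho)}{\rho}\le\lambda<\frac{\theta}{2}\cdot\frac{r^2(\rho)}{\rho},$$ then on the event $\mathcal{A}$, a regularized empirical minimizer $\hat f\in\operatorname{argmin}_{f\in F}P_N\mathcal{L}_f^\lambda$ satisfies $$\Psi(\hat f-f^* )\le\rho\quad\text{and}\quad\|\hat f-f^*\|_{L_2(\mu)}\le r(\rho).$$ Moreover, the same assertion holds (with $\Delta(\rho)\ge4\rho/5$) if $$\frac{3\theta}{8}\cdot\frac{r^2(\rho)}{\rho}\le\lambda<\frac{\theta}{2}\cdot\frac{r^2(\rho)}{\rho}.$$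
   Context: Setting. $(\Omega,\mu)$ is a probability space, $X$ is distributed according to $\mu$, $Y$ is a square-integrable random variable, $E\subset L_2(\mu)$ is a vector space of functions, $\Psi$ is a norm on $E$, and $F\subset E$ is closed (in $L_2(\mu)$) and convex. $f^*$ is the (unique) minimizer in $F$ of $f\mapsto\mathbb{E}(f(X)-Y)^2$, $\xi=f^*(X)-Y$, $(X_i,Y_i)_{i=1}^N$ are independent copies of $(X,Y)$, and $\xi_i=f^*(X_i)-Y_i$. $P_Nh=\frac1N\sum_{i=1}^Nh(X_i,Y_i)$. $B_\Psi(\rho,f^* )=\{f\in E:\Psi(f-f^* )\le\rho\}$, $S_\Psi(\rho,f^* )=\{f\in E:\Psi(f-f^* )=\rho\}$, $D(r,f^* )=\{f\in E:\|f-f^*\|_{L_2(\mu)}\le r\}$. Small-ball condition. There are constants $\kappa>0$ and $0<\varepsilon\le1$ with $Pr(|f-h|\ge\kappa\|f-h\|_{L_2(\mu)})\ge\varepsilon$ for every $f,h\in F\cup\{0\}$. Put $\theta=\kappa^2\varepsilon/16$ and fix $0<\delta<1$. Losses. $\mathcal{L}_f(X,Y)=(f(X)-Y)^2-(f^*(X)-Y)^2$ and $\mathcal{L}_f^\lambda=\mathcal{L}_f+\lambda(\Psi(f)-\Psi(f^* ))$, so $P_N\mathcal{L}_f^\lambda=P_N\mathcal{L}_f+\lambda(\Psi(f)-\Psi(f^* ))$. For $w\in L_2(\mu)$, $\mathcal{M}_w=\xi w-\mathbb{E}\xi w$, so $P_N\mathcal{M}_w=\frac1N\sum_{i=1}^N\xi_iw(X_i)-\mathbb{E}\,\xi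 w(X)$. Critical levels. Let $(\varepsilon_i)_{i=1}^N$ be independent symmetric $\{-1,1\}$-valued random variables, independent of $(X_i,Y_i)_{i=1}^N$. For a convex class $H\subset F$ containing $f^*$ let $$r_Q(H,\gamma)=\inf\Big\{r>0:\mathbb{E}\sup_{h\in H\cap D(r,f^* )}\Big|\tfrac1N\sum_{i=1}^N\varepsilon_i(h-f^* )(X_i)\Big|\le\gamma r\Big\},$$ $$\phi_N(H,s)=\sup_{h\in H\cap D(s,f^* )}\Big|\tfrac1{\sqrt N}\sum_{i=1}^N\varepsilon_i\xi_i(h-f^* )(X_i)\Big|,\qquad r_M(H,\gamma,\delta)=\inf\{s>0:Pr(\phi_N(H,s)\le\gamma s^2\sqrt N)\ge1-\delta\}.$$ Set $r_M(\rho)=r_M(F\cap B_\Psi(\rho,f^* ),\theta/10,\delta/4)$ and $r_Q(\rho)=r_Q(F\cap B_\Psi(\rho,f^* ),\kappa\varepsilon/32)$, and let $r(\cdot)$ be a function with $r(\rho)\ge\sup_{f^*\in F}\max\{r_Q(\rho),r_M(\rho)\}$ (in particular the inequality holds for the $f^*$ at hand). Put $$\mathcal{O}(\rho)=\sup_{f\in F\cap B_\Psi(\rho,f^* )\cap D(r(\rho),f^* )}|P_N\mathcal{M}_{f-f^*}|.$$ (It is known that an event $\mathcal{A}$ on which (i) and (ii) hold exists with probability at least $1-\delta-2\exp(-N\varepsilon^2/2)$.) The parameter $\Delta$. $E^*$ is the dual of $(E,\Psi)$ and $S_{\Psi^*}$ is its unit sphere. $z^*\in S_{\Psi^*}$ is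 a norming functional for $z\in E$ if $z^*(z)=\Psi(z)$. $\Gamma_{f^*}(\rho)$ is the set of all functionals that are norming for some $f\in B_\Psi(\rho/20,f^* )$, and $$\Delta(\rho)=\inf_{h\in F\cap S_\Psi(\rho,f^* )\cap D(r(\rho),f^* )}\ \sup_{z^*\in\Gamma_{f^*}(\rho)}z^*(h-f^* ).$$ *)

theory Defs
  imports "HOL-Probability.Probability"
begin

section \<open>Function classes in L2\<close>

text \<open>
  Elements of a class are genuine functions, because they are evaluated at the sample points;
  the identification of functions that agree almost everywhere is made explicit where it matters.
  Differences \<open>f - g\<close> of functions are pointwise.
\<close>

definition L2 :: "'a measure \<Rightarrow> ('a \<Rightarrow> real) set" where
  "L2 \<mu> = {f \<in> borel_measurable \<mu>. integrable \<mu> (\<lambda>x. (f x)\<^sup>2)}"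

definition L2_norm :: "'a measure \<Rightarrow> ('a \<Rightarrow> real) \<Rightarrow> real" where
  "L2_norm \<mu> f = sqrt (\<integral>x. (f x)\<^sup>2 \<partial>\<mu>)"

definition function_space :: "('a \<Rightarrow> real) set \<Rightarrow> bool" where
  "function_space E \<longleftrightarrow> (\<lambda>_. 0) \<in> E \<and>
     (\<forall>f\<in>E. \<forall>g\<in>E. (\<lambda>x. f x + g x) \<in> E) \<and> (\<forall>c. \<forall>f\<in>E. (\<lambda>x. c * f x) \<in> E)"

text \<open>
  Definiteness is required up to \<open>\<mu>\<close>-null sets, so that both a norm on functions and a norm on
  almost-everywhere classes (for which \<open>\<Psi>\<close> vanishes on null functions) are covered.
\<close>

definition norm_on :: "'a measure \<Rightarrow> ('a \<Rightarrow> real) set \<Rightarrow> (('a \<Rightarrow> real) \<Rightarrow> real) \<Rightarrow> bool" where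
  "norm_on \<mu> E \<Psi> \<longleftrightarrow>
     (\<forall>f\<in>E. 0 \<le> \<Psi> f) \<and>
     (\<forall>f\<in>E. \<Psi> f = 0 \<longrightarrow> (AE x in \<mu>. f x = 0)) \<and>
     (\<forall>c. \<forall>f\<in>E. \<Psi> (\<lambda>x. c * f x) = \<bar>c\<bar> * \<Psi> f) \<and>
     (\<forall>f\<in>E. \<forall>g\<in>E. \<Psi> (\<lambda>x. f x + g x) \<le> \<Psi> f + \<Psi> g)"

definition convex_class :: "('a \<Rightarrow> real) set \<Rightarrow> bool" where
  "convex_class F \<longleftrightarrow>
     (\<forall>f\<in>F. \<forall>g\<in>F. \<forall>u\<ge>0. \<forall>v\<ge>0. u + v = 1 \<longrightarrow> (\<lambda>x. u * f x + v * g x) \<in> F)"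

text \<open>The set of classes modulo almost-everywhere equality that \<open>F\<close> represents is closed in L2.\<close>

definition L2_closed :: "'a measure \<Rightarrow> ('a \<Rightarrow> real) set \<Rightarrow> bool" where
  "L2_closed \<mu> F \<longleftrightarrow>
     (\<forall>u. \<forall>g\<in>L2 \<mu>. (\<forall>n. u n \<in> F) \<and> (\<lambda>n. L2_norm \<mu> (u n - g)) \<longlonglongrightarrow> 0 \<longrightarrow>
        (\<exists>f\<in>F. AE x in \<mu>. f x = g x))"

definition Psi_ball ::
  "('a \<Rightarrow> real) set \<Rightarrow> (('a \<Rightarrow> real) \<Rightarrow> real) \<Rightarrow> real \<Rightarrow> ('a \<Rightarrow> real) \<Rightarrow> ('a \<Rightarrow> real) set" where
  "Psi_ball E \<Psi> \<rho> f0 = {f \<in> E. \<Psi> (f - f0) \<le> \<rho>}"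

definition Psi_sphere ::
  "('a \<Rightarrow> real) set \<Rightarrow> (('a \<Rightarrow> real) \<Rightarrow> real) \<Rightarrow> real \<Rightarrow> ('a \<Rightarrow> real) \<Rightarrow> ('a \<Rightarrow> real) set" where
  "Psi_sphere E \<Psi> \<rho> f0 = {f \<in> E. \<Psi> (f - f0) = \<rho>}"

definition L2_ball ::
  "'a measure \<Rightarrow> ('a \<Rightarrow> real) set \<Rightarrow> real \<Rightarrow> ('a \<Rightarrow> real) \<Rightarrow> ('a \<Rightarrow> real) set" where
  "L2_ball \<mu> E s f0 = {f \<in> E. L2_norm \<mu> (f - f0) \<le> s}"

definition small_ball :: "'a measure \<Rightarrow> ('a \<Rightarrow> real) set \<Rightarrow> real \<Rightarrow> real \<Rightarrow> bool" where
  "small_ball \<mu> F \<kappa> \<epsilon> \<longleftrightarrow>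
     (\<forall>f \<in> F \<union> {\<lambda>_. 0}. \<forall>h \<in> F \<union> {\<lambda>_. 0}.
        measure \<mu> {x \<in> space \<mu>. \<bar>f x - h x\<bar> \<ge> \<kappa> * L2_norm \<mu> (f - h)} \<ge> \<epsilon>)"

definition theta :: "real \<Rightarrow> real \<Rightarrow> real" where
  "theta \<kappa> \<epsilon> = \<kappa>\<^sup>2 * \<epsilon> / 16"


section \<open>Losses and empirical means\<close>

definition emp_mean ::
  "nat \<Rightarrow> (nat \<Rightarrow> 'w \<Rightarrow> 'a) \<Rightarrow> (nat \<Rightarrow> 'w \<Rightarrow> real) \<Rightarrow> ('a \<Rightarrow> real \<Rightarrow> real) \<Rightarrow> 'w \<Rightarrow> real" where
  "emp_mean N Xs Ys h \<omega> = (\<Sum>i=1..N. h (Xs i \<omega>) (Ys i \<omega>)) / real N"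

definition excess_loss :: "('a \<Rightarrow> real) \<Rightarrow> ('a \<Rightarrow> real) \<Rightarrow> 'a \<Rightarrow> real \<Rightarrow> real" where
  "excess_loss fstar f x y = (f x - y)\<^sup>2 - (fstar x - y)\<^sup>2"

definition reg_excess_loss ::
  "(('a \<Rightarrow> real) \<Rightarrow> real) \<Rightarrow> real \<Rightarrow> ('a \<Rightarrow> real) \<Rightarrow> ('a \<Rightarrow> real) \<Rightarrow> 'a \<Rightarrow> real \<Rightarrow> real" where
  "reg_excess_loss \<Psi> lam fstar f x y = excess_loss fstar f x y + lam * (\<Psi> f - \<Psi> fstar)"

definition multiplier ::
  "'w measure \<Rightarrow> ('w \<Rightarrow> 'a) \<Rightarrow> ('w \<Rightarrow> real) \<Rightarrow> ('a \<Rightarrow> real) \<Rightarrow> ('a \<Rightarrow> real) \<Rightarrow> 'a \<Rightarrow> real \<Rightarrow> real" where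
  "multiplier M X Y fstar w x y =
     (fstar x - y) * w x - (\<integral>\<omega>. (fstar (X \<omega>) - Y \<omega>) * w (X \<omega>) \<partial>M)"


section \<open>Critical levels\<close>

text \<open>
  Suprema and infima are taken in the extended reals, so that the infimum of an empty set is
  infinite and the supremum of an unbounded family is not an arbitrary real number.
\<close>

definition r_Q_level ::
  "'w measure \<Rightarrow> 'a measure \<Rightarrow> nat \<Rightarrow> (nat \<Rightarrow> 'w \<Rightarrow> 'a) \<Rightarrow> (nat \<Rightarrow> 'w \<Rightarrow> real) \<Rightarrow>
   ('a \<Rightarrow> real) set \<Rightarrow> ('a \<Rightarrow> real) \<Rightarrow> ('a \<Rightarrow> real) set \<Rightarrow> real \<Rightarrow> ereal" where
  "r_Q_level M \<mu> N Xs sgns E fstar H \<gamma> =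
     Inf (ereal ` {s. 0 < s \<and>
       (\<integral>\<^sup>+\<omega>. (SUP h \<in> H \<inter> L2_ball \<mu> E s fstar.
           ennreal \<bar>(1 / real N) * (\<Sum>i=1..N. sgns i \<omega> * (h - fstar) (Xs i \<omega>))\<bar>) \<partial>M)
       \<le> ennreal (\<gamma> * s)})"

definition phi_N ::
  "'a measure \<Rightarrow> nat \<Rightarrow> (nat \<Rightarrow> 'w \<Rightarrow> 'a) \<Rightarrow> (nat \<Rightarrow> 'w \<Rightarrow> real) \<Rightarrow> (nat \<Rightarrow> 'w \<Rightarrow> real) \<Rightarrow>
   ('a \<Rightarrow> real) set \<Rightarrow> ('a \<Rightarrow> real) \<Rightarrow> ('a \<Rightarrow> real) set \<Rightarrow> real \<Rightarrow> 'w \<Rightarrow> ereal" where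
  "phi_N \<mu> N Xs Ys sgns E fstar H s \<omega> =
     (SUP h \<in> H \<inter> L2_ball \<mu> E s fstar.
        ereal \<bar>(1 / sqrt (real N)) *
          (\<Sum>i=1..N. sgns i \<omega> * (fstar (Xs i \<omega>) - Ys i \<omega>) * (h - fstar) (Xs i \<omega>))\<bar>)"

definition r_M_level ::
  "'w measure \<Rightarrow> 'a measure \<Rightarrow> nat \<Rightarrow> (nat \<Rightarrow> 'w \<Rightarrow> 'a) \<Rightarrow> (nat \<Rightarrow> 'w \<Rightarrow> real) \<Rightarrow>
   (nat \<Rightarrow> 'w \<Rightarrow> real) \<Rightarrow> ('a \<Rightarrow> real) set \<Rightarrow> ('a \<Rightarrow> real) \<Rightarrow> ('a \<Rightarrow> real) set \<Rightarrow>
   real \<Rightarrow> real \<Rightarrow> ereal" where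
  "r_M_level M \<mu> N Xs Ys sgns E fstar H \<gamma> \<delta> =
     Inf (ereal ` {s. 0 < s \<and>
       measure M {\<omega> \<in> space M. phi_N \<mu> N Xs Ys sgns E fstar H s \<omega> \<le> ereal (\<gamma> * s\<^sup>2 * sqrt (real N))}
       \<ge> 1 - \<delta>})"

text \<open>The random variable \<open>\<O>(\<rho>)\<close>; the argument \<open>rr\<close> is the value \<open>r(\<rho>)\<close>.\<close>

definition multiplier_osc ::
  "'w measure \<Rightarrow> 'a measure \<Rightarrow> ('w \<Rightarrow> 'a) \<Rightarrow> ('w \<Rightarrow> real) \<Rightarrow> nat \<Rightarrow> (nat \<Rightarrow> 'w \<Rightarrow> 'a) \<Rightarrow>
   (nat \<Rightarrow> 'w \<Rightarrow> real) \<Rightarrow> ('a \<Rightarrow> real) set \<Rightarrow> (('a \<Rightarrow> real) \<Rightarrow> real) \<Rightarrow> ('a \<Rightarrow> real) set \<Rightarrow>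
   ('a \<Rightarrow> real) \<Rightarrow> real \<Rightarrow> real \<Rightarrow> 'w \<Rightarrow> ereal" where
  "multiplier_osc M \<mu> X Y N Xs Ys E \<Psi> F fstar \<rho> rr \<omega> =
     (SUP f \<in> F \<inter> Psi_ball E \<Psi> \<rho> fstar \<inter> L2_ball \<mu> E rr fstar.
        ereal \<bar>emp_mean N Xs Ys (multiplier M X Y fstar (f - fstar)) \<omega>\<bar>)"


section \<open>Norming functionals and the parameter Delta\<close>

text \<open>
  A functional on \<open>E\<close> is a map on all functions of which only the values on \<open>E\<close> matter.
  Dual norm one includes boundedness, since the dual norm is an extended real.
\<close>

definition linear_functional_on :: "('a \<Rightarrow> real) set \<Rightarrow> (('a \<Rightarrow> real) \<Rightarrow> real) \<Rightarrow> bool" where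
  "linear_functional_on E z \<longleftrightarrow>
     (\<forall>f\<in>E. \<forall>g\<in>E. z (\<lambda>x. f x + g x) = z f + z g) \<and> (\<forall>c. \<forall>f\<in>E. z (\<lambda>x. c * f x) = c * z f)"

definition dual_norm ::
  "('a \<Rightarrow> real) set \<Rightarrow> (('a \<Rightarrow> real) \<Rightarrow> real) \<Rightarrow> (('a \<Rightarrow> real) \<Rightarrow> real) \<Rightarrow> ereal" where
  "dual_norm E \<Psi> z = (SUP f \<in> {f \<in> E. \<Psi> f \<le> 1}. ereal \<bar>z f\<bar>)"

definition dual_sphere ::
  "('a \<Rightarrow> real) set \<Rightarrow> (('a \<Rightarrow> real) \<Rightarrow> real) \<Rightarrow> (('a \<Rightarrow> real) \<Rightarrow> real) set" where
  "dual_sphere E \<Psi> = {z. linear_functional_on E z \<and> dual_norm E \<Psi> z = 1}"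

definition norming_for ::
  "('a \<Rightarrow> real) set \<Rightarrow> (('a \<Rightarrow> real) \<Rightarrow> real) \<Rightarrow> ('a \<Rightarrow> real) \<Rightarrow> (('a \<Rightarrow> real) \<Rightarrow> real) set" where
  "norming_for E \<Psi> f = {z \<in> dual_sphere E \<Psi>. z f = \<Psi> f}"

definition Gamma_norming ::
  "('a \<Rightarrow> real) set \<Rightarrow> (('a \<Rightarrow> real) \<Rightarrow> real) \<Rightarrow> ('a \<Rightarrow> real) \<Rightarrow> real \<Rightarrow> (('a \<Rightarrow> real) \<Rightarrow> real) set" where
  "Gamma_norming E \<Psi> fstar \<rho> = (\<Union>f \<in> Psi_ball E \<Psi> (\<rho> / 20) fstar. norming_for E \<Psi> f)"

definition Delta ::
  "'a measure \<Rightarrow> ('a \<Rightarrow> real) set \<Rightarrow> (('a \<Rightarrow> real) \<Rightarrow> real) \<Rightarrow> ('a \<Rightarrow> real) set \<Rightarrow> ('a \<Rightarrow> real) \<Rightarrow>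
   real \<Rightarrow> real \<Rightarrow> ereal" where
  "Delta \<mu> E \<Psi> F fstar \<rho> rr =
     (INF h \<in> F \<inter> Psi_sphere E \<Psi> \<rho> fstar \<inter> L2_ball \<mu> E rr fstar.
        SUP z \<in> Gamma_norming E \<Psi> fstar \<rho>. ereal (z (h - fstar)))"


section \<open>The learning problem\<close>

text \<open>
  All random variables live on one probability space \<open>M\<close>; \<open>\<mu>\<close> is the law of \<open>X\<close>.
  The minimizer \<open>fstar\<close> is unique up to \<open>\<mu>\<close>-null sets because \<open>F\<close> is convex.
  In the assumption \<open>r_dominates\<close>, the bound on \<open>r\<close> is only required for the given \<open>fstar\<close>; this is
  implied by a bound uniform over all possible minimizers in \<open>F\<close>.
\<close>

locale regularized_learning = prob_space M
  for M :: "'w measure" +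
  fixes \<mu> :: "'a measure"
    and X :: "'w \<Rightarrow> 'a" and Y :: "'w \<Rightarrow> real"
    and N :: nat and Xs :: "nat \<Rightarrow> 'w \<Rightarrow> 'a" and Ys :: "nat \<Rightarrow> 'w \<Rightarrow> real"
    and sgns :: "nat \<Rightarrow> 'w \<Rightarrow> real"
    and E :: "('a \<Rightarrow> real) set" and \<Psi> :: "('a \<Rightarrow> real) \<Rightarrow> real"
    and F :: "('a \<Rightarrow> real) set" and fstar :: "'a \<Rightarrow> real"
    and \<kappa> \<epsilon> \<delta> :: real and r :: "real \<Rightarrow> real"
  assumes X_measurable: "X \<in> measurable M \<mu>"
    and X_law: "distr M \<mu> X = \<mu>"
    and Y_measurable: "Y \<in> borel_measurable M"
    and Y_square_integrable: "integrable M (\<lambda>\<omega>. (Y \<omega>)\<^sup>2)"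
    and N_pos: "N \<ge> 1"
    and sample_indep: "indep_vars (\<lambda>_. \<mu> \<Otimes>\<^sub>M borel) (\<lambda>i \<omega>. (Xs i \<omega>, Ys i \<omega>)) {1..N}"
    and sample_law: "\<And>i. i \<in> {1..N} \<Longrightarrow>
          distr M (\<mu> \<Otimes>\<^sub>M borel) (\<lambda>\<omega>. (Xs i \<omega>, Ys i \<omega>)) = distr M (\<mu> \<Otimes>\<^sub>M borel) (\<lambda>\<omega>. (X \<omega>, Y \<omega>))"
    and signs_indep: "indep_vars (\<lambda>_. borel) sgns {1..N}"
    and signs_values: "\<And>i \<omega>. i \<in> {1..N} \<Longrightarrow> \<omega> \<in> space M \<Longrightarrow> sgns i \<omega> \<in> {-1, 1}"
    and signs_symmetric: "\<And>i. i \<in> {1..N} \<Longrightarrow>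
          prob {\<omega> \<in> space M. sgns i \<omega> = 1} = 1 / 2 \<and> prob {\<omega> \<in> space M. sgns i \<omega> = -1} = 1 / 2"
    and signs_sample_indep:
          "indep_set {(\<lambda>\<omega>. \<lambda>i\<in>{1..N}. sgns i \<omega>) -` A \<inter> space M | A.
                        A \<in> sets (Pi\<^sub>M {1..N} (\<lambda>_. borel))}
                     {(\<lambda>\<omega>. \<lambda>i\<in>{1..N}. (Xs i \<omega>, Ys i \<omega>)) -` B \<inter> space M | B.
                        B \<in> sets (Pi\<^sub>M {1..N} (\<lambda>_. \<mu> \<Otimes>\<^sub>M borel))}"
    and E_space: "function_space E"
    and E_L2: "E \<subseteq> L2 \<mu>"
    and Psi_norm: "norm_on \<mu> E \<Psi>"
    and F_subset: "F \<subseteq> E"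
    and F_closed: "L2_closed \<mu> F"
    and F_convex: "convex_class F"
    and fstar_minimizer:
          "is_arg_min (\<lambda>f. expectation (\<lambda>\<omega>. (f (X \<omega>) - Y \<omega>)\<^sup>2)) (\<lambda>f. f \<in> F) fstar"
    and kappa_pos: "0 < \<kappa>"
    and eps_range: "0 < \<epsilon>" "\<epsilon> \<le> 1"
    and small_ball_condition: "small_ball \<mu> F \<kappa> \<epsilon>"
    and delta_range: "0 < \<delta>" "\<delta> < 1"
    and r_dominates: "\<And>s. 0 < s \<Longrightarrow>
          max (r_Q_level M \<mu> N Xs sgns E fstar (F \<inter> Psi_ball E \<Psi> s fstar) (\<kappa> * \<epsilon> / 32))
              (r_M_level M \<mu> N Xs Ys sgns E fstar (F \<inter> Psi_ball E \<Psi> s fstar)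
                 (theta \<kappa> \<epsilon> / 10) (\<delta> / 4))
          \<le> ereal (r s)"

end

theory Submission
  imports Defs
begin

text \<open>
  Along the ray from \<open>fstar\<close> through \<open>f\<close> the regularized empirical excess loss grows at least
  linearly, by convexity, so it suffices that it is positive on the \<open>\<Psi>\<close>-sphere of radius \<open>\<rho>\<close>.
  Where \<open>h\<close> is far from \<open>fstar\<close> in \<open>L2\<close>, property (i) beats the regularization term, which is at
  least \<open>- lam * \<rho>\<close>. Where \<open>h\<close> is close, the loss is at least \<open>- 2 * \<O>(\<rho>)\<close>, because
  the first-order condition at \<open>fstar\<close> gives \<open>0 \<le> \<E> \<xi> (h - fstar)(X)\<close>, while functionals
  norming points near \<open>fstar\<close> give \<open>\<Psi> h - \<Psi> fstar \<ge> 4/5 \<rho> - 2 * \<rho>/20 = 7/10 \<rho>\<close>; and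
  \<open>7/10 > 2/3\<close>.
\<close>

section \<open>Function spaces and their norms\<close>

lemma function_space_add:
  assumes "function_space E" "f \<in> E" "g \<in> E"
  shows "(\<lambda>x. f x + g x) \<in> E"
  using assms unfolding function_space_def by blast

lemma function_space_cmult:
  assumes "function_space E" "f \<in> E"
  shows "(\<lambda>x. c * f x) \<in> E"
  using assms unfolding function_space_def by blast

lemma function_space_diff:
  assumes "function_space E" "f \<in> E" "g \<in> E"
  shows "f - g \<in> E"
proof -
  have "(\<lambda>x. f x + (- 1) * g x) \<in> E"
    by (intro function_space_add function_space_cmult assms)
  also have "(\<lambda>x. f x + (- 1) * g x) = f - g"
    by (rule ext) simp
  finally show ?thesis .
qed

lemma norm_on_triangle:
  assumes "norm_on \<mu> E \<Psi>" "f \<in> E" "g \<in> E"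
  shows "\<Psi> (\<lambda>x. f x + g x) \<le> \<Psi> f + \<Psi> g"
  using assms by (simp add: norm_on_def)

lemma norm_on_cmult:
  assumes "norm_on \<mu> E \<Psi>" "f \<in> E"
  shows "\<Psi> (\<lambda>x. c * f x) = \<bar>c\<bar> * \<Psi> f"
  using assms by (simp add: norm_on_def)

lemma norm_on_minus_commute:
  assumes "norm_on \<mu> E \<Psi>" "function_space E" "f \<in> E" "g \<in> E"
  shows "\<Psi> (f - g) = \<Psi> (g - f)"
proof -
  have "\<Psi> (\<lambda>x. (- 1) * (g - f) x) = \<Psi> (g - f)"
    by (subst norm_on_cmult[OF assms(1) function_space_diff]) (use assms in auto)
  also have "(\<lambda>x. (- 1) * (g - f) x) = f - g"
    by (rule ext) simp
  finally show ?thesis .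
qed

lemma norm_on_diff_le:
  assumes "norm_on \<mu> E \<Psi>" "function_space E" "f \<in> E" "g \<in> E"
  shows "\<Psi> f - \<Psi> g \<le> \<Psi> (f - g)"
  using norm_on_triangle[OF assms(1) function_space_diff[OF assms(2-4)] assms(4)] by simp

section \<open>Norming functionals and the parameter \<open>Delta\<close>\<close>

lemma dual_sphere_le_norm:
  assumes norm: "norm_on \<mu> E \<Psi>" and space: "function_space E"
    and z: "z \<in> dual_sphere E \<Psi>" and f: "f \<in> E"
  shows "\<bar>z f\<bar> \<le> \<Psi> f"
proof (rule field_le_epsilon)
  fix e :: real assume "0 < e"
  have "0 \<le> \<Psi> f"
    using norm f by (simp add: norm_on_def)
  \<comment> \<open>Scaling by \<open>\<Psi> f + e\<close> instead of \<open>\<Psi> f\<close> keeps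
    the denominator positive when \<open>\<Psi> f = 0\<close>, which may happen even for a nonzero
    \<open>f\<close> that vanishes almost everywhere.\<close>
  define c where "c = 1 / (\<Psi> f + e)"
  have "0 < c"
    using \<open>0 < e\<close> \<open>0 \<le> \<Psi> f\<close> by (simp add: c_def)
  have "(\<lambda>x. c * f x) \<in> E"
    by (rule function_space_cmult[OF space f])
  moreover have "\<Psi> (\<lambda>x. c * f x) \<le> 1"
  proof -
    have "\<Psi> (\<lambda>x. c * f x) = c * \<Psi> f"
      using norm_on_cmult[OF norm f] \<open>0 < c\<close> by simp
    also have "\<dots> \<le> 1"
      using \<open>0 < e\<close> \<open>0 \<le> \<Psi> f\<close> by (simp add: c_def divide_simps)
    finally show ?thesis .
  qed
  ultimately have "ereal \<bar>z (\<lambda>x. c * f x)\<bar> \<le> dual_norm E \<Psi> z"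
    unfolding dual_norm_def by (intro SUP_upper) simp
  then have "\<bar>z (\<lambda>x. c * f x)\<bar> \<le> 1"
    using z by (simp add: dual_sphere_def)
  moreover have "z (\<lambda>x. c * f x) = c * z f"
    using z f by (simp add: dual_sphere_def linear_functional_on_def)
  ultimately have "c * \<bar>z f\<bar> \<le> 1"
    using \<open>0 < c\<close> by (simp add: abs_mult)
  then show "\<bar>z f\<bar> \<le> \<Psi> f + e"
    using \<open>0 < e\<close> \<open>0 \<le> \<Psi> f\<close> by (simp add: c_def divide_simps)
qed

text \<open>A functional norming \<open>f\<close> is a subgradient of \<open>\<Psi>\<close> at
  \<open>f\<close>; it remains one at \<open>g\<close> up to an error. Evaluating it at f + (h - g)
  gives \<Psi> f + z (h - g) \<le> \<Psi> h + \<Psi> (f - g), and replacing \<Psi> f by \<Psi> g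
  costs another \<Psi> (f - g).\<close>

lemma norming_increment:
  assumes norm: "norm_on \<mu> E \<Psi>" and space: "function_space E"
    and mem: "f \<in> E" "g \<in> E" "h \<in> E"
    and z: "z \<in> norming_for E \<Psi> f"
  shows "z (h - g) \<le> \<Psi> h - \<Psi> g + 2 * \<Psi> (f - g)"
proof -
  note diff = function_space_diff[OF space]
  have z': "z \<in> dual_sphere E \<Psi>" "z f = \<Psi> f"
    using z by (auto simp: norming_for_def)
  have hg: "h - g \<in> E" "f - g \<in> E"
    using mem diff by auto
  have "(\<lambda>x. f x + (h - g) x) \<in> E"
    by (rule function_space_add[OF space mem(1) hg(1)])
  then have "z (\<lambda>x. f x + (h - g) x) \<le> \<Psi> (\<lambda>x. f x + (h - g) x)"
    using dual_sphere_le_norm[OF norm space z'(1)] by (meson abs_le_D1)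
  moreover have "z (\<lambda>x. f x + (h - g) x) = z f + z (h - g)"
    using z'(1) mem(1) hg(1) unfolding dual_sphere_def linear_functional_on_def by blast
  moreover have "\<Psi> (\<lambda>x. f x + (h - g) x) \<le> \<Psi> h + \<Psi> (f - g)"
    using norm_on_triangle[OF norm mem(3) hg(2)] by (simp add: algebra_simps)
  moreover have "\<Psi> g - \<Psi> f \<le> \<Psi> (f - g)"
    using norm_on_diff_le[OF norm space mem(2,1)] norm_on_minus_commute[OF norm space mem(2,1)]
    by simp
  ultimately show ?thesis
    using z'(2) by linarith
qed

text \<open>Here \<open>h\<close> is a competitor in the infimum, and every \<open>z\<close> in the
  supremum norms some point within \<rho>/20 of \<open>g\<close>. The subgradient error is thus at
  most 2 * \<rho>/20, uniformly in \<open>z\<close>, so the bound survives the supremum.\<close>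

lemma Delta_le_increment:
  assumes norm: "norm_on \<mu> E \<Psi>" and space: "function_space E" and g: "g \<in> E"
    and h: "h \<in> F \<inter> Psi_sphere E \<Psi> \<rho> g \<inter> L2_ball \<mu> E s g"
  shows "Delta \<mu> E \<Psi> F g \<rho> s \<le> ereal (\<Psi> h - \<Psi> g + \<rho> / 10)"
proof -
  have hE: "h \<in> E"
    using h by (simp add: Psi_sphere_def)
  have "Delta \<mu> E \<Psi> F g \<rho> s \<le> (SUP z \<in> Gamma_norming E \<Psi> g \<rho>. ereal (z (h - g)))"
    unfolding Delta_def using h by (rule INF_lower)
  also have "\<dots> \<le> ereal (\<Psi> h - \<Psi> g + \<rho> / 10)"
  proof (rule SUP_least)
    fix z assume "z \<in> Gamma_norming E \<Psi> g \<rho>"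
    then obtain f where f: "f \<in> E" "\<Psi> (f - g) \<le> \<rho> / 20" "z \<in> norming_for E \<Psi> f"
      by (auto simp: Gamma_norming_def Psi_ball_def)
    show "ereal (z (h - g)) \<le> ereal (\<Psi> h - \<Psi> g + \<rho> / 10)"
      using norming_increment[OF norm space f(1) g hE f(3)] f(2) by simp
  qed
  finally show ?thesis .
qed

section \<open>Convexity of the regularized loss, empirical means and a limit argument\<close>

lemma reg_excess_loss_segment:
  assumes norm: "norm_on \<mu> E \<Psi>" and space: "function_space E"
    and fg: "f \<in> E" "g \<in> E" and t: "0 \<le> t" "t \<le> 1" and lam: "0 \<le> lam"
  shows "reg_excess_loss \<Psi> lam g (\<lambda>u. (1 - t) * g u + t * f u) x y
    \<le> t * reg_excess_loss \<Psi> lam g f x y"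
proof -
  \<comment> \<open>At parameter \<open>t\<close> the deviation from \<open>g\<close> is t * w, so
    the loss is a quadratic in \<open>t\<close> without constant term. Its linear part scales
    exactly by \<open>t\<close>, and its square part by t^2 \<le> t.\<close>
  define w where "w = f x - g x"
  have "excess_loss g (\<lambda>u. (1 - t) * g u + t * f u) x y = t\<^sup>2 * w\<^sup>2 + 2 * t * w * (g x - y)"
    by (simp add: excess_loss_def w_def power2_eq_square algebra_simps)
  moreover have "excess_loss g f x y = w\<^sup>2 + 2 * w * (g x - y)"
    by (simp add: excess_loss_def w_def power2_eq_square algebra_simps)
  moreover have "t\<^sup>2 * w\<^sup>2 \<le> t * w\<^sup>2"
    using t by (intro mult_right_mono) (auto simp: power2_eq_square mult_left_le)
  ultimately have loss: "excess_loss g (\<lambda>u. (1 - t) * g u + t * f u) x y \<le> t * excess_loss g f x y"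
    by (simp only: distrib_left)
  have "(\<lambda>u. (1 - t) * g u) \<in> E" "(\<lambda>u. t * f u) \<in> E"
    using function_space_cmult[OF space] fg by auto
  then have "\<Psi> (\<lambda>u. (1 - t) * g u + t * f u) \<le> \<Psi> (\<lambda>u. (1 - t) * g u) + \<Psi> (\<lambda>u. t * f u)"
    by (rule norm_on_triangle[OF norm])
  also have "\<dots> = (1 - t) * \<Psi> g + t * \<Psi> f"
    using norm_on_cmult[OF norm fg(2)] norm_on_cmult[OF norm fg(1)] t by simp
  finally have "\<Psi> (\<lambda>u. (1 - t) * g u + t * f u) - \<Psi> g \<le> t * (\<Psi> f - \<Psi> g)"
    by (simp add: algebra_simps)
  from mult_left_mono[OF this lam] loss show ?thesis
    by (simp add: reg_excess_loss_def algebra_simps)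
qed

lemma emp_mean_mono:
  assumes "\<And>x y. g x y \<le> h x y"
  shows "emp_mean N Xs Ys g \<omega> \<le> emp_mean N Xs Ys h \<omega>"
  unfolding emp_mean_def by (intro divide_right_mono sum_mono assms) simp

lemma emp_mean_cmult: "emp_mean N Xs Ys (\<lambda>x y. c * h x y) \<omega> = c * emp_mean N Xs Ys h \<omega>"
  by (simp add: emp_mean_def sum_distrib_left)

lemma emp_mean_add_const:
  assumes "N \<ge> 1"
  shows "emp_mean N Xs Ys (\<lambda>x y. h x y + c) \<omega> = emp_mean N Xs Ys h \<omega> + c"
  using assms by (simp add: emp_mean_def sum.distrib add_divide_distrib)

text \<open>Let t tend to 0 from the right. In the application \<open>a\<close> is a directional
  derivative of the risk and \<open>t * b\<close> the remainder after division by \<open>t\<close>;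
  the range 0 < t \<le> 1 is the one that convexity of \<open>F\<close> provides.\<close>

lemma nonneg_of_perturbation:
  fixes a b :: real
  assumes "\<And>t. 0 < t \<Longrightarrow> t \<le> 1 \<Longrightarrow> 0 \<le> a + t * b"
  shows "0 \<le> a"
proof (rule tendsto_lowerbound)
  have "((\<lambda>t. a + t * b) \<longlongrightarrow> a + 0 * b) (at_right 0)"
    by (intro tendsto_intros)
  then show "((\<lambda>t. a + t * b) \<longlongrightarrow> a) (at_right 0)"
    by simp
  show "\<forall>\<^sub>F t in at_right 0. 0 \<le> a + t * b"
    using assms unfolding eventually_at_right_field by (intro exI[of _ 1]) auto
qed simp

context regularized_learning
begin

section \<open>First-order optimality of \<open>fstar\<close> and its effect on the empirical
  loss\<close>

lemma fstar_in_F: "fstar \<in> F"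
  using fstar_minimizer by (simp add: is_arg_min_def)

lemma integrable_prod_of_squares:
  fixes f g :: "'w \<Rightarrow> real"
  assumes [measurable]: "f \<in> borel_measurable M" "g \<in> borel_measurable M"
    and "integrable M (\<lambda>\<omega>. (f \<omega>)\<^sup>2)" "integrable M (\<lambda>\<omega>. (g \<omega>)\<^sup>2)"
  shows "integrable M (\<lambda>\<omega>. f \<omega> * g \<omega>)"
proof (rule Bochner_Integration.integrable_bound)
  show "integrable M (\<lambda>\<omega>. (f \<omega>)\<^sup>2 + (g \<omega>)\<^sup>2)"
    using assms by simp
  have "\<bar>a * b\<bar> \<le> a\<^sup>2 + b\<^sup>2" for a b :: real
    using sum_squares_bound[of "\<bar>a\<bar>" "\<bar>b\<bar>"] abs_ge_zero[of "a * b"]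
    unfolding abs_mult power2_abs by linarith
  then show "AE \<omega> in M. norm (f \<omega> * g \<omega>) \<le> norm ((f \<omega>)\<^sup>2 + (g \<omega>)\<^sup>2)"
    by simp
qed simp

lemma
  assumes "f \<in> L2 \<mu>"
  shows measurable_comp_X: "(\<lambda>\<omega>. f (X \<omega>)) \<in> borel_measurable M"
    and integrable_square_comp_X: "integrable M (\<lambda>\<omega>. (f (X \<omega>))\<^sup>2)"
proof -
  have f: "f \<in> borel_measurable \<mu>" "integrable \<mu> (\<lambda>x. (f x)\<^sup>2)"
    using assms by (auto simp: L2_def)
  show "(\<lambda>\<omega>. f (X \<omega>)) \<in> borel_measurable M"
    using measurable_compose[OF X_measurable f(1)] .
  have "integrable (distr M \<mu> X) (\<lambda>x. (f x)\<^sup>2)"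
    using f(2) by (simp add: X_law)
  then show "integrable M (\<lambda>\<omega>. (f (X \<omega>))\<^sup>2)"
    using f(1) X_measurable by (subst (asm) integrable_distr_eq) auto
qed

text \<open>The segment from \<open>fstar\<close> to \<open>h\<close> stays in \<open>F\<close>, so
  the risk along it is minimal at its starting point, and its one-sided derivative there, twice this
  expectation, cannot be negative.\<close>

lemma residual_first_order:
  assumes h: "h \<in> F"
  shows "0 \<le> expectation (\<lambda>\<omega>. (fstar (X \<omega>) - Y \<omega>) * (h - fstar) (X \<omega>))"
proof -
  have L2: "fstar \<in> L2 \<mu>" "h - fstar \<in> L2 \<mu>"
    using E_L2 F_subset fstar_in_F h function_space_diff[OF E_space, of h fstar] by auto
  note [measurable] = measurable_comp_X[OF L2(1)] measurable_comp_X[OF L2(2)] Y_measurable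
  define \<xi> where "\<xi> \<omega> = fstar (X \<omega>) - Y \<omega>" for \<omega>
  define w where "w \<omega> = (h - fstar) (X \<omega>)" for \<omega>
  have [measurable]: "\<xi> \<in> borel_measurable M" "w \<in> borel_measurable M"
    unfolding \<xi>_def w_def by measurable
  have w2: "integrable M (\<lambda>\<omega>. (w \<omega>)\<^sup>2)"
    unfolding w_def by (rule integrable_square_comp_X[OF L2(2)])
  have "integrable M (\<lambda>\<omega>. (fstar (X \<omega>))\<^sup>2 + (Y \<omega>)\<^sup>2 - 2 * (fstar (X \<omega>) * Y \<omega>))"
    by (intro Bochner_Integration.integrable_diff Bochner_Integration.integrable_add
        integrable_mult_right integrable_prod_of_squares integrable_square_comp_X[OF L2(1)]
        Y_square_integrable) measurable
  then have \<xi>2: "integrable M (\<lambda>\<omega>. (\<xi> \<omega>)\<^sup>2)"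
    by (simp add: \<xi>_def power2_diff algebra_simps)
  have \<xi>w: "integrable M (\<lambda>\<omega>. \<xi> \<omega> * w \<omega>)"
    by (intro integrable_prod_of_squares \<xi>2 w2) measurable
  \<comment> \<open>With a the left-hand quantity and b the second moment of \<open>w\<close>, the
    risk at parameter \<open>t\<close> exceeds the minimal risk by t * (a + t * b). Dividing by
    \<open>t\<close> gives the form required by the limit argument.\<close>
  have "0 \<le> 2 * expectation (\<lambda>\<omega>. \<xi> \<omega> * w \<omega>)"
  proof (rule nonneg_of_perturbation)
    fix t :: real assume t: "0 < t" "t \<le> 1"
    define f where "f = (\<lambda>x. (1 - t) * fstar x + t * h x)"
    have "f \<in> F"
      unfolding f_def using F_convex fstar_in_F h t by (simp add: convex_class_def)
    then have "expectation (\<lambda>\<omega>. (\<xi> \<omega>)\<^sup>2) \<le> expectation (\<lambda>\<omega>. (f (X \<omega>) - Y \<omega>)\<^sup>2)"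
      using fstar_minimizer unfolding is_arg_min_def \<xi>_def by (meson not_less)
    also have "(\<lambda>\<omega>. (f (X \<omega>) - Y \<omega>)\<^sup>2) = (\<lambda>\<omega>. (\<xi> \<omega>)\<^sup>2 + (2 * t * (\<xi> \<omega> * w \<omega>) + t\<^sup>2 * (w \<omega>)\<^sup>2))"
      by (rule ext) (simp add: f_def \<xi>_def w_def power2_eq_square algebra_simps)
    also have "expectation \<dots> = expectation (\<lambda>\<omega>. (\<xi> \<omega>)\<^sup>2)
        + (2 * t * expectation (\<lambda>\<omega>. \<xi> \<omega> * w \<omega>) + t\<^sup>2 * expectation (\<lambda>\<omega>. (w \<omega>)\<^sup>2))"
      using \<xi>2 \<xi>w w2 by simp
    finally have "0 \<le> t * (2 * expectation (\<lambda>\<omega>. \<xi> \<omega> * w \<omega>) + t * expectation (\<lambda>\<omega>. (w \<omega>)\<^sup>2))"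
      by (simp add: power2_eq_square algebra_simps)
    then show "0 \<le> 2 * expectation (\<lambda>\<omega>. \<xi> \<omega> * w \<omega>) + t * expectation (\<lambda>\<omega>. (w \<omega>)\<^sup>2)"
      using t(1) by (simp add: zero_le_mult_iff)
  qed
  then show ?thesis
    by (simp add: \<xi>_def w_def)
qed

text \<open>The inequality already holds pointwise: dropping the square (h - fstar)^2 lowers the
  loss, and centering the multiplier subtracts an expectation that is nonnegative by
  optimality.\<close>

lemma emp_excess_loss_ge_multiplier:
  assumes h: "h \<in> F"
  shows "2 * emp_mean N Xs Ys (multiplier M X Y fstar (h - fstar)) \<omega>
    \<le> emp_mean N Xs Ys (excess_loss fstar h) \<omega>"
proof -
  define e where "e = expectation (\<lambda>\<omega>. (fstar (X \<omega>) - Y \<omega>) * (h - fstar) (X \<omega>))"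
  have "0 \<le> e"
    unfolding e_def by (rule residual_first_order[OF h])
  have "2 * multiplier M X Y fstar (h - fstar) x y \<le> excess_loss fstar h x y" for x y
  proof -
    define p where "p = (fstar x - y) * (h - fstar) x"
    have "excess_loss fstar h x y = (h x - fstar x)\<^sup>2 + 2 * p"
      by (simp add: excess_loss_def p_def power2_eq_square algebra_simps)
    then have "2 * p \<le> excess_loss fstar h x y"
      by simp
    then show ?thesis
      using \<open>0 \<le> e\<close> unfolding multiplier_def p_def[symmetric] e_def[symmetric] by simp
  qed
  then show ?thesis
    unfolding emp_mean_cmult[symmetric] by (rule emp_mean_mono)
qed

section \<open>Localization of the regularized minimizer\<close>

lemma emp_reg_excess_loss:
  "emp_mean N Xs Ys (reg_excess_loss \<Psi> lam fstar f) \<omega>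
    = emp_mean N Xs Ys (excess_loss fstar f) \<omega> + lam * (\<Psi> f - \<Psi> fstar)"
  unfolding reg_excess_loss_def by (rule emp_mean_add_const[OF N_pos])

text \<open>\<open>r \<rho>\<close> dominates an infimum of positive radii. The sign is what permits
  squaring \<open>r \<rho> \<le> L2_norm \<mu> (f - fstar)\<close> later.\<close>

lemma r_nonneg:
  assumes "0 < \<rho>"
  shows "0 \<le> r \<rho>"
proof -
  have "0 \<le> r_Q_level M \<mu> N Xs sgns E fstar (F \<inter> Psi_ball E \<Psi> \<rho> fstar) (\<kappa> * \<epsilon> / 32)"
    unfolding r_Q_level_def by (rule Inf_greatest) auto
  also have "\<dots> \<le> ereal (r \<rho>)"
    using r_dominates[OF assms] by simp
  finally show ?thesis
    by simp
qed

text \<open>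
  The bound \<open>\<gamma>\<close> on the multiplier process is \<open>\<gamma>\<^sub>\<O>(\<rho>)\<close> in the first part of the theorem and
  \<open>\<theta> r\<^sup>2(\<rho>) / 8\<close> in the second.
\<close>

lemma regularized_minimizer_localized:
  assumes \<rho>: "0 < \<rho>" and lam: "0 < lam"
    and far: "\<And>f. f \<in> F \<inter> Psi_ball E \<Psi> \<rho> fstar \<Longrightarrow> r \<rho> \<le> L2_norm \<mu> (f - fstar) \<Longrightarrow>
      c * (L2_norm \<mu> (f - fstar))\<^sup>2 \<le> emp_mean N Xs Ys (excess_loss fstar f) \<omega>"
    and close: "\<And>f. f \<in> F \<inter> Psi_ball E \<Psi> \<rho> fstar \<inter> L2_ball \<mu> E (r \<rho>) fstar \<Longrightarrow>
      \<bar>emp_mean N Xs Ys (multiplier M X Y fstar (f - fstar)) \<omega>\<bar> \<le> \<gamma>"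
    and Delta: "ereal (4 * \<rho> / 5) \<le> Delta \<mu> E \<Psi> F fstar \<rho> (r \<rho>)"
    and lam_lower: "3 * \<gamma> \<le> lam * \<rho>" and lam_upper: "lam * \<rho> < c * (r \<rho>)\<^sup>2"
    and argmin: "is_arg_min (\<lambda>f. emp_mean N Xs Ys (reg_excess_loss \<Psi> lam fstar f) \<omega>)
      (\<lambda>f. f \<in> F) fhat"
  shows "\<Psi> (fhat - fstar) \<le> \<rho> \<and> L2_norm \<mu> (fhat - fstar) \<le> r \<rho>"
proof -
  let ?L = "\<lambda>f. emp_mean N Xs Ys (reg_excess_loss \<Psi> lam fstar f) \<omega>"
  have fstarE: "fstar \<in> E"
    using fstar_in_F F_subset by auto
  \<comment> \<open>Forced by the upper bound on \<open>lam\<close>: 0 < lam * \<rho> < c * (r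
    \<rho>)^2.\<close>
  have "0 < c"
    using \<rho> lam lam_upper zero_le_power2[of "r \<rho>"]
    by (metis dual_order.strict_trans less_le_not_le mult_pos_pos zero_less_mult_pos2
        zero_less_mult_iff)
  \<comment> \<open>Covers the whole \<open>\<Psi>\<close>-ball because it is used twice: for the
    far points of the sphere, and for \<open>fhat\<close> itself when its \<open>L2\<close> distance
    is bounded.\<close>
  have far_pos: "0 < ?L f"
    if f: "f \<in> F" "\<Psi> (f - fstar) \<le> \<rho>" and far_f: "r \<rho> \<le> L2_norm \<mu> (f - fstar)" for f
  proof -
    have fE: "f \<in> E"
      using f F_subset by auto
    have "c * (r \<rho>)\<^sup>2 \<le> c * (L2_norm \<mu> (f - fstar))\<^sup>2"
      using \<open>0 < c\<close> far_f r_nonneg[OF \<rho>] by (simp add: power_mono)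
    moreover have "c * (L2_norm \<mu> (f - fstar))\<^sup>2 \<le> emp_mean N Xs Ys (excess_loss fstar f) \<omega>"
      using f far_f fE by (intro far) (auto simp: Psi_ball_def)
    moreover have "\<Psi> fstar - \<Psi> f \<le> \<rho>"
      using norm_on_diff_le[OF Psi_norm E_space fstarE fE]
        norm_on_minus_commute[OF Psi_norm E_space fstarE fE] f(2) by simp
    then have "lam * (\<Psi> fstar - \<Psi> f) \<le> lam * \<rho>"
      using lam by (simp add: mult_left_mono)
    ultimately show ?thesis
      using lam_upper unfolding emp_reg_excess_loss by (simp add: algebra_simps)
  qed
  have sphere_pos: "0 < ?L h" if h: "h \<in> F" "\<Psi> (h - fstar) = \<rho>" for h
  proof (cases "r \<rho> \<le> L2_norm \<mu> (h - fstar)")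
    case True
    with h show ?thesis
      by (intro far_pos) auto
  next
    case False
    have hE: "h \<in> E"
      using h F_subset by auto
    have "\<bar>emp_mean N Xs Ys (multiplier M X Y fstar (h - fstar)) \<omega>\<bar> \<le> \<gamma>"
      using h False hE by (intro close) (auto simp: Psi_ball_def L2_ball_def)
    then have "- 2 * \<gamma> \<le> emp_mean N Xs Ys (excess_loss fstar h) \<omega>"
      using emp_excess_loss_ge_multiplier[OF h(1), of \<omega>] by linarith
    moreover have "h \<in> F \<inter> Psi_sphere E \<Psi> \<rho> fstar \<inter> L2_ball \<mu> E (r \<rho>) fstar"
      using h False hE by (auto simp: Psi_sphere_def L2_ball_def)
    from order_trans[OF Delta Delta_le_increment[OF Psi_norm E_space fstarE this]]
    have "7 / 10 * \<rho> \<le> \<Psi> h - \<Psi> fstar"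
      by simp
    then have "lam * (7 / 10 * \<rho>) \<le> lam * (\<Psi> h - \<Psi> fstar)"
      using lam by (intro mult_left_mono) auto
    \<comment> \<open>By \<open>lam_lower\<close> the loss is at least -2/3 * lam * \<rho>, while
      the regularization adds at least 7/10 * lam * \<rho>; a margin of lam * \<rho> / 30
      remains.\<close>
    ultimately show ?thesis
      using lam_lower mult_pos_pos[OF lam \<rho>] unfolding emp_reg_excess_loss by linarith
  qed
  have fhat: "fhat \<in> F" "fhat \<in> E"
    using argmin F_subset by (auto simp: is_arg_min_def)
  have "?L fstar = 0"
    by (simp add: emp_mean_def reg_excess_loss_def excess_loss_def)
  then have L_fhat: "?L fhat \<le> 0"
    using argmin fstar_in_F unfolding is_arg_min_def by (metis not_less)
  have Psi_le: "\<Psi> (fhat - fstar) \<le> \<rho>"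
  proof (rule ccontr)
    assume "\<not> \<Psi> (fhat - fstar) \<le> \<rho>"
    \<comment> \<open>The parameter at which the segment from \<open>fstar\<close> to
      \<open>fhat\<close> crosses the sphere of radius \<rho>. Positivity there would force
      \<open>?L fhat > 0\<close>, against minimality.\<close>
    define t where "t = \<rho> / \<Psi> (fhat - fstar)"
    have t: "0 < t" "t \<le> 1"
      using \<open>\<not> \<Psi> (fhat - fstar) \<le> \<rho>\<close> \<rho> by (auto simp: t_def)
    define h where "h = (\<lambda>x. (1 - t) * fstar x + t * fhat x)"
    have "h \<in> F"
      unfolding h_def using F_convex fstar_in_F fhat t by (simp add: convex_class_def)
    moreover have "h - fstar = (\<lambda>x. t * (fhat - fstar) x)"
      by (rule ext) (simp add: h_def algebra_simps)
    then have "\<Psi> (h - fstar) = t * \<Psi> (fhat - fstar)"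
      using norm_on_cmult[OF Psi_norm function_space_diff[OF E_space fhat(2) fstarE]] t(1)
      by simp
    then have "\<Psi> (h - fstar) = \<rho>"
      using \<open>\<not> \<Psi> (fhat - fstar) \<le> \<rho>\<close> \<rho> by (simp add: t_def)
    ultimately have "0 < ?L h"
      by (rule sphere_pos)
    also have "?L h \<le> t * ?L fhat"
      unfolding emp_mean_cmult[symmetric] h_def using t lam fhat(2) fstarE
      by (intro emp_mean_mono reg_excess_loss_segment[OF Psi_norm E_space]) auto
    finally show False
      using L_fhat t(1) by (simp add: zero_less_mult_iff)
  qed
  \<comment> \<open>Now that \<open>fhat\<close> is known to lie in the \<open>\<Psi>\<close>-ball,
    \<open>far_pos\<close> applies to it: a distance of at least \<open>r \<rho>\<close> would
    contradict \<open>L_fhat\<close>.\<close>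
  moreover have "L2_norm \<mu> (fhat - fstar) \<le> r \<rho>"
    using far_pos[OF fhat(1) Psi_le] L_fhat by linarith
  ultimately show ?thesis ..
qed

end

theorem theorem3p2:
  fixes M :: "'w measure" and \<mu> :: "'a measure"
    and X :: "'w \<Rightarrow> 'a" and Y :: "'w \<Rightarrow> real"
    and N :: nat and Xs :: "nat \<Rightarrow> 'w \<Rightarrow> 'a" and Ys :: "nat \<Rightarrow> 'w \<Rightarrow> real"
    and sgns :: "nat \<Rightarrow> 'w \<Rightarrow> real"
    and E F :: "('a \<Rightarrow> real) set" and \<Psi> :: "('a \<Rightarrow> real) \<Rightarrow> real" and fstar :: "'a \<Rightarrow> real"
    and \<kappa> \<epsilon> \<delta> \<rho> lam :: real and r :: "real \<Rightarrow> real" and A :: "'w set"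
  assumes setting: "regularized_learning M \<mu> X Y N Xs Ys sgns E \<Psi> F fstar \<kappa> \<epsilon> \<delta> r"
    and rho_pos: "0 < \<rho>"
    and A_event: "A \<in> sets M"
    and property_i: "\<And>\<omega> f. \<omega> \<in> A \<Longrightarrow> f \<in> F \<inter> Psi_ball E \<Psi> \<rho> fstar \<Longrightarrow>
          L2_norm \<mu> (f - fstar) \<ge> r \<rho> \<Longrightarrow>
          emp_mean N Xs Ys (excess_loss fstar f) \<omega> \<ge> theta \<kappa> \<epsilon> / 2 * (L2_norm \<mu> (f - fstar))\<^sup>2"
    and property_ii: "\<And>\<omega>. \<omega> \<in> A \<Longrightarrow>
          multiplier_osc M \<mu> X Y N Xs Ys E \<Psi> F fstar \<rho> (r \<rho>) \<omega> \<le> ereal (theta \<kappa> \<epsilon> / 8 * (r \<rho>)\<^sup>2)"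
    and lambda_pos: "0 < lam"
    and Delta_large: "Delta \<mu> E \<Psi> F fstar \<rho> (r \<rho>) \<ge> ereal (4 * \<rho> / 5)"
  shows
    "(3 * (SUP \<omega>\<in>A. multiplier_osc M \<mu> X Y N Xs Ys E \<Psi> F fstar \<rho> (r \<rho>) \<omega>) / ereal \<rho> \<le> ereal lam \<and>
      lam < theta \<kappa> \<epsilon> / 2 * ((r \<rho>)\<^sup>2 / \<rho>) \<longrightarrow>
        (\<forall>\<omega>\<in>A. \<forall>fhat.
           is_arg_min (\<lambda>f. emp_mean N Xs Ys (reg_excess_loss \<Psi> lam fstar f) \<omega>) (\<lambda>f. f \<in> F) fhat \<longrightarrow>
           \<Psi> (fhat - fstar) \<le> \<rho> \<and> L2_norm \<mu> (fhat - fstar) \<le> r \<rho>)) \<and>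
     (3 * theta \<kappa> \<epsilon> / 8 * ((r \<rho>)\<^sup>2 / \<rho>) \<le> lam \<and>
      lam < theta \<kappa> \<epsilon> / 2 * ((r \<rho>)\<^sup>2 / \<rho>) \<longrightarrow>
        (\<forall>\<omega>\<in>A. \<forall>fhat.
           is_arg_min (\<lambda>f. emp_mean N Xs Ys (reg_excess_loss \<Psi> lam fstar f) \<omega>) (\<lambda>f. f \<in> F) fhat \<longrightarrow>
           \<Psi> (fhat - fstar) \<le> \<rho> \<and> L2_norm \<mu> (fhat - fstar) \<le> r \<rho>))"
proof -
  interpret regularized_learning M \<mu> X Y N Xs Ys sgns E \<Psi> F fstar \<kappa> \<epsilon> \<delta> r
    by (fact setting)
  let ?O = "multiplier_osc M \<mu> X Y N Xs Ys E \<Psi> F fstar \<rho> (r \<rho>)"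
  let ?P = "\<lambda>\<omega> f. emp_mean N Xs Ys (multiplier M X Y fstar (f - fstar)) \<omega>"
  have osc: "ereal \<bar>?P \<omega> f\<bar> \<le> ?O \<omega>"
    if "f \<in> F \<inter> Psi_ball E \<Psi> \<rho> fstar \<inter> L2_ball \<mu> E (r \<rho>) fstar" for \<omega> f
    unfolding multiplier_osc_def using that by (rule SUP_upper)
  \<comment> \<open>Both assertions are instances of this one; only the choice of \<gamma>
    differs.\<close>
  have localized: "\<Psi> (fhat - fstar) \<le> \<rho> \<and> L2_norm \<mu> (fhat - fstar) \<le> r \<rho>"
    if \<omega>: "\<omega> \<in> A" and bound: "?O \<omega> \<le> ereal \<gamma>" and lower: "3 * \<gamma> \<le> lam * \<rho>"
      and upper: "lam < theta \<kappa> \<epsilon> / 2 * ((r \<rho>)\<^sup>2 / \<rho>)"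
      and argmin: "is_arg_min (\<lambda>f. emp_mean N Xs Ys (reg_excess_loss \<Psi> lam fstar f) \<omega>)
        (\<lambda>f. f \<in> F) fhat" for \<omega> fhat \<gamma>
  proof (rule regularized_minimizer_localized[OF rho_pos lambda_pos property_i[OF \<omega>] _ Delta_large
        lower _ argmin])
    fix f assume "f \<in> F \<inter> Psi_ball E \<Psi> \<rho> fstar \<inter> L2_ball \<mu> E (r \<rho>) fstar"
    then show "\<bar>?P \<omega> f\<bar> \<le> \<gamma>"
      using order_trans[OF osc bound] by simp
  next
    show "lam * \<rho> < theta \<kappa> \<epsilon> / 2 * (r \<rho>)\<^sup>2"
      using upper rho_pos by (simp add: field_simps)
  qed
  show ?thesis
  proof (intro conjI impI ballI allI; elim conjE)
    fix \<omega> fhat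
    assume \<omega>: "\<omega> \<in> A"
      and lower: "3 * (SUP \<omega>\<in>A. ?O \<omega>) / ereal \<rho> \<le> ereal lam"
      and upper: "lam < theta \<kappa> \<epsilon> / 2 * ((r \<rho>)\<^sup>2 / \<rho>)"
      and argmin: "is_arg_min (\<lambda>f. emp_mean N Xs Ys (reg_excess_loss \<Psi> lam fstar f) \<omega>)
        (\<lambda>f. f \<in> F) fhat"
    \<comment> \<open>The bound passed on is \<open>lam * \<rho> / 3\<close>, a real number that
      dominates the supremum over \<open>A\<close> and turns
      \<open>3 * \<gamma> \<le> lam * \<rho>\<close> into an equality.\<close>
    have "?O \<omega> \<le> ereal (lam * \<rho> / 3)"
    proof -
      have "3 * ?O \<omega> \<le> 3 * (SUP \<omega>\<in>A. ?O \<omega>)"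
        using \<omega> by (intro ereal_mult_left_mono SUP_upper) auto
      also have "\<dots> \<le> ereal (lam * \<rho>)"
        using lower rho_pos by (simp add: ereal_divide_le_pos mult.commute)
      finally show ?thesis
        \<comment> \<open>The preceding chain excludes the value infinity, and minus infinity
          satisfies the bound trivially.\<close>
        by (cases "?O \<omega>") auto
    qed
    from localized[OF \<omega> this _ upper argmin]
    show "\<Psi> (fhat - fstar) \<le> \<rho>" "L2_norm \<mu> (fhat - fstar) \<le> r \<rho>"
      by auto
  next
    fix \<omega> fhat
    assume \<omega>: "\<omega> \<in> A"
      and lower: "3 * theta \<kappa> \<epsilon> / 8 * ((r \<rho>)\<^sup>2 / \<rho>) \<le> lam"
      and upper: "lam < theta \<kappa> \<epsilon> / 2 * ((r \<rho>)\<^sup>2 / \<rho>)"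
      and argmin: "is_arg_min (\<lambda>f. emp_mean N Xs Ys (reg_excess_loss \<Psi> lam fstar f) \<omega>)
        (\<lambda>f. f \<in> F) fhat"
    \<comment> \<open>With \<gamma> taken from \<open>property_ii\<close>, the lower bound on
      \<open>lam\<close> is exactly \<open>3 * \<gamma> \<le> lam * \<rho>\<close>.\<close>
    have "3 * (theta \<kappa> \<epsilon> / 8 * (r \<rho>)\<^sup>2) \<le> lam * \<rho>"
      using lower rho_pos by (simp add: field_simps)
    from localized[OF \<omega> property_ii[OF \<omega>] this upper argmin]
    show "\<Psi> (fhat - fstar) \<le> \<rho>" "L2_norm \<mu> (fhat - fstar) \<le> r \<rho>"
      by auto
  qed
qed

end
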